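(* Let $(X,\mathcal{F},\mu)$ be a measure space and $\varphi:X\to X$ a non-singular measurable transformation such that the composition operator $C_\varphi f=f\circ\varphi$ is bounded on $L^2(\mu)$. Let $m\in\mathbb{N}$. The composition operator $C_\varphi$ is quasi-$m$-isometry if and only if $$\sum_{k=0}^{m}(-1)^{m-k}\binom{m}{k}h_{k+1}=0\quad\mu\text{-a.e.},$$ and also, $C_\varphi$ is $m$-isometry if and only if $$\sum_{k=0}^{m}(-1)^{m-k}\binom{m}{k}h_{k}=0\quad\mu\text{-a.e.}$$
   Context: A bounded operator $T$ on a complex Hilbert space is called $m$-isometry if $B_m=\sum_{k=0}^{m}(-1)^{m-k}\binom{m}{k}T^{*k}T^{k}=0$, and quasi-$m$-isometry if $T^*B_mT=\sum_{k=0}^{m}(-1)^{m-k}\binom{m}{k}T^{*(k+1)}T^{k+1}=0$. The map $\varphi$ is non-singular if $\mu\circ\varphi^{-1}\ll\mu$. For $n\ge1$, $h_n=\frac{d\mu\circ\varphi^{-n}}{d\mu}$ is the Radon–Nikodym derivative of $\mu\circ\varphi^{-n}$ with respect to $\mu$, and $h_0=1$.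
   Formalization: The measure space is not arbitrary: all derivatives h_n are assumed to exist and be unique μ-a.e., including h_0=1 as the only density of μ with respect to itself (so μ is semifinite); this holds for σ-finite μ, and without it the claim can fail. *)

theory Defs
  imports "HOL-Analysis.Analysis"
begin

section \<open>The complex Hilbert space \<open>L\<^sup>2(\<mu>)\<close>\<close>

text \<open>
  As is usual for \<^const>\<open>integrable\<close> in HOL-Analysis, elements of \<open>L\<^sup>2(\<mu>)\<close> are given by
  representatives, and equality in \<open>L\<^sup>2(\<mu>)\<close> is equality almost everywhere.
\<close>

definition L2 :: "'a measure \<Rightarrow> ('a \<Rightarrow> complex) set" where
  "L2 M = {f \<in> borel_measurable M. integrable M (\<lambda>x. (cmod (f x))\<^sup>2)}"

definition L2_inner :: "'a measure \<Rightarrow> ('a \<Rightarrow> complex) \<Rightarrow> ('a \<Rightarrow> complex) \<Rightarrow> complex" where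
  "L2_inner M f g = (\<integral>x. f x * cnj (g x) \<partial>M)"

definition L2_norm :: "'a measure \<Rightarrow> ('a \<Rightarrow> complex) \<Rightarrow> real" where
  "L2_norm M f = sqrt (\<integral>x. (cmod (f x))\<^sup>2 \<partial>M)"

text \<open>
  Additivity and boundedness force \<open>T\<close> to respect equality almost everywhere, so such a \<open>T\<close>
  does induce an operator on the space of equivalence classes.
\<close>

definition bounded_operator_L2 ::
    "'a measure \<Rightarrow> (('a \<Rightarrow> complex) \<Rightarrow> ('a \<Rightarrow> complex)) \<Rightarrow> bool" where
  "bounded_operator_L2 M T \<longleftrightarrow>
     (\<forall>f\<in>L2 M. T f \<in> L2 M) \<and>
     (\<forall>f\<in>L2 M. \<forall>g\<in>L2 M. AE x in M. T (\<lambda>y. f y + g y) x = T f x + T g x) \<and>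
     (\<forall>c. \<forall>f\<in>L2 M. AE x in M. T (\<lambda>y. c * f y) x = c * T f x) \<and>
     (\<exists>C. \<forall>f\<in>L2 M. L2_norm M (T f) \<le> C * L2_norm M f)"

definition is_adjoint_L2 ::
    "'a measure \<Rightarrow> (('a \<Rightarrow> complex) \<Rightarrow> ('a \<Rightarrow> complex)) \<Rightarrow>
     (('a \<Rightarrow> complex) \<Rightarrow> ('a \<Rightarrow> complex)) \<Rightarrow> bool" where
  "is_adjoint_L2 M T S \<longleftrightarrow>
     (\<forall>g\<in>L2 M. S g \<in> L2 M) \<and>
     (\<forall>f\<in>L2 M. \<forall>g\<in>L2 M. L2_inner M (T f) g = L2_inner M f (S g))"

text \<open>
  The adjoint of a bounded operator exists by the Riesz representation theorem; on \<open>L2 M\<close> its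
  values are unique up to equality almost everywhere.
\<close>

definition adjoint_L2 ::
    "'a measure \<Rightarrow> (('a \<Rightarrow> complex) \<Rightarrow> ('a \<Rightarrow> complex)) \<Rightarrow>
     (('a \<Rightarrow> complex) \<Rightarrow> ('a \<Rightarrow> complex))" where
  "adjoint_L2 M T = (SOME S. is_adjoint_L2 M T S)"

section \<open>\<open>m\<close>-isometries and quasi-\<open>m\<close>-isometries\<close>

definition defect_operator ::
    "'a measure \<Rightarrow> nat \<Rightarrow> (('a \<Rightarrow> complex) \<Rightarrow> ('a \<Rightarrow> complex)) \<Rightarrow>
     (('a \<Rightarrow> complex) \<Rightarrow> ('a \<Rightarrow> complex))" where
  "defect_operator M m T f =
     (\<lambda>x. \<Sum>k=0..m. (-1) ^ (m - k) * of_nat (m choose k) *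
              ((adjoint_L2 M T ^^ k) ((T ^^ k) f)) x)"

definition m_isometry :: "'a measure \<Rightarrow> nat \<Rightarrow> (('a \<Rightarrow> complex) \<Rightarrow> ('a \<Rightarrow> complex)) \<Rightarrow> bool" where
  "m_isometry M m T \<longleftrightarrow> (\<forall>f\<in>L2 M. AE x in M. defect_operator M m T f x = 0)"

definition quasi_m_isometry ::
    "'a measure \<Rightarrow> nat \<Rightarrow> (('a \<Rightarrow> complex) \<Rightarrow> ('a \<Rightarrow> complex)) \<Rightarrow> bool" where
  "quasi_m_isometry M m T \<longleftrightarrow>
     (\<forall>f\<in>L2 M. AE x in M. adjoint_L2 M T (defect_operator M m T (T f)) x = 0)"

section \<open>Composition operators and Radon--Nikodym derivatives\<close>

definition nonsingular :: "'a measure \<Rightarrow> ('a \<Rightarrow> 'a) \<Rightarrow> bool" where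
  "nonsingular M \<phi> \<longleftrightarrow> absolutely_continuous M (distr M M \<phi>)"

definition composition_operator :: "('a \<Rightarrow> 'a) \<Rightarrow> ('a \<Rightarrow> complex) \<Rightarrow> ('a \<Rightarrow> complex)" where
  "composition_operator \<phi> f = f \<circ> \<phi>"

text \<open>
  \<open>h_RN\<close> takes values in \<open>[0, \<infinity>]\<close>. When the composition operator is bounded and the derivatives are
  well defined in the sense below, they are finite almost everywhere, so that applying
  \<^const>\<open>enn2real\<close> loses nothing.
\<close>

definition h_RN :: "'a measure \<Rightarrow> ('a \<Rightarrow> 'a) \<Rightarrow> nat \<Rightarrow> 'a \<Rightarrow> ennreal" where
  "h_RN M \<phi> n = (if n = 0 then (\<lambda>x. 1) else RN_deriv M (distr M M (\<phi> ^^ n)))"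

text \<open>
  Without \<open>\<sigma>\<close>-finiteness, Radon--Nikodym derivatives need neither exist nor be unique almost
  everywhere. The following states that \<open>dN/dM\<close> is well defined. For \<open>n = 0\<close> in
  \<open>RN_derivs_well_defined\<close> this says that \<open>1\<close> is the only density of \<open>\<mu>\<close> with respect to itself,
  so that \<open>h\<^sub>0 = 1\<close> is the derivative \<open>d\<mu>/d\<mu>\<close>; this rules out atoms of infinite measure,
  on which densities are not determined.
\<close>

definition has_unique_RN_deriv :: "'a measure \<Rightarrow> 'a measure \<Rightarrow> bool" where
  "has_unique_RN_deriv M N \<longleftrightarrow>
     (\<exists>f\<in>borel_measurable M. density M f = N \<and>
        (\<forall>g\<in>borel_measurable M. density M g = N \<longrightarrow> (AE x in M. g x = (f x :: ennreal))))"

definition RN_derivs_well_defined :: "'a measure \<Rightarrow> ('a \<Rightarrow> 'a) \<Rightarrow> bool" where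
  "RN_derivs_well_defined M \<phi> \<longleftrightarrow> (\<forall>n. has_unique_RN_deriv M (distr M M (\<phi> ^^ n)))"

lemma measurable_funpow:
  assumes "\<phi> \<in> measurable M M"
  shows "(\<phi> ^^ n) \<in> measurable M M"
proof (induction n)
  case (Suc n)
  then show ?case
    using measurable_comp[OF Suc assms] by (simp only: funpow.simps)
qed (simp add: id_def)

lemma nonsingular_funpow:
  assumes "\<phi> \<in> measurable M M" and "nonsingular M \<phi>"
  shows "nonsingular M (\<phi> ^^ n)"
proof (induction n)
  case 0
  have "distr M M id = M"
    by (simp add: id_def distr_id)
  then show ?case
    by (simp add: nonsingular_def absolutely_continuous_def)
next
  case (Suc n)
  have "null_sets M \<subseteq> null_sets (distr M M (\<phi> ^^ Suc n))"
  proof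
    fix A assume A: "A \<in> null_sets M"
    then have [measurable]: "A \<in> sets M" by auto
    note [measurable] = assms(1) measurable_funpow[OF assms(1)]
    have "A \<in> null_sets (distr M M \<phi>)"
      using A assms(2) by (auto simp: nonsingular_def absolutely_continuous_def)
    then have "\<phi> -` A \<inter> space M \<in> null_sets M"
      by (simp add: null_sets_distr_iff assms(1))
    then have "\<phi> -` A \<inter> space M \<in> null_sets (distr M M (\<phi> ^^ n))"
      using Suc by (auto simp: nonsingular_def absolutely_continuous_def)
    then have "(\<phi> ^^ n) -` (\<phi> -` A \<inter> space M) \<inter> space M \<in> null_sets M"
      by (simp add: null_sets_distr_iff)
    moreover have "(\<phi> ^^ n) -` (\<phi> -` A \<inter> space M) \<inter> space M = (\<phi> ^^ Suc n) -` A \<inter> space M"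
      using measurable_space[OF measurable_funpow[OF assms(1)], of _ n] by auto
    ultimately show "A \<in> null_sets (distr M M (\<phi> ^^ Suc n))"
      using measurable_funpow[OF assms(1), of "Suc n"]
      by (simp add: null_sets_distr_iff del: funpow.simps)
  qed
  then show ?case
    unfolding nonsingular_def absolutely_continuous_def .
qed

text \<open>On a \<open>\<sigma>\<close>-finite measure space all the derivatives \<open>h\<^sub>n\<close> are well defined.\<close>

lemma (in sigma_finite_measure) RN_derivs_well_defined:
  assumes "\<phi> \<in> measurable M M" and "nonsingular M \<phi>"
  shows "RN_derivs_well_defined M \<phi>"
  unfolding RN_derivs_well_defined_def
proof
  fix n
  have "absolutely_continuous M (distr M M (\<phi> ^^ n))"
    using nonsingular_funpow[OF assms] by (simp add: nonsingular_def)
  then obtain f where f: "f \<in> borel_measurable M" "density M f = distr M M (\<phi> ^^ n)"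
    using Radon_Nikodym[of "distr M M (\<phi> ^^ n)"] by auto
  moreover have "AE x in M. g x = f x"
    if "g \<in> borel_measurable M" "density M g = distr M M (\<phi> ^^ n)" for g
    using that f density_unique_iff[of g f] by simp
  ultimately show "has_unique_RN_deriv M (distr M M (\<phi> ^^ n))"
    unfolding has_unique_RN_deriv_def by blast
qed

end

theory Submission
  imports Defs
begin

text \<open>
  For \<open>T f = f \<circ> \<phi>\<close> a change of variables gives
  \<open>\<langle>f, T\<^sup>*\<^sup>k T\<^sup>k g\<rangle> = \<langle>T\<^sup>k f, T\<^sup>k g\<rangle> = \<integral> h\<^sub>k f g\<^sup>* d\<mu>\<close>, so \<open>T\<^sup>*\<^sup>k T\<^sup>k\<close> is multiplication by
  \<open>h\<^sub>k\<close>, and \<open>B\<^sub>m\<close> and \<open>T\<^sup>* B\<^sub>m T\<close> are multiplications by the two alternating sums. A multiplication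
  operator vanishes only if its symbol does, since uniqueness of the density \<open>d\<mu>/d\<mu>\<close> forces \<open>\<mu>\<close> to
  be semifinite. The adjoint exists by the Riesz representation theorem, obtained here from the
  completeness of \<open>L\<^sup>2\<close>.
\<close>

section \<open>\<open>L2 M\<close> as an inner product space of representatives\<close>

lemma borel_measurable_cnj [measurable (raw)]:
  "f \<in> borel_measurable M \<Longrightarrow> (\<lambda>x. cnj (f x)) \<in> borel_measurable M"
  by (erule measurable_compose) (intro borel_measurable_continuous_onI continuous_intros)

lemma L2_measurable: "f \<in> L2 M \<Longrightarrow> f \<in> borel_measurable M"
  and L2_integrable: "f \<in> L2 M \<Longrightarrow> integrable M (\<lambda>x. (cmod (f x))\<^sup>2)"
  by (auto simp: L2_def)

lemma L2_dominated:
  assumes "f \<in> borel_measurable M" "integrable M w" "\<And>x. (cmod (f x))\<^sup>2 \<le> w x"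
  shows "f \<in> L2 M"
proof -
  note [measurable] = assms(1)
  have "integrable M (\<lambda>x. (cmod (f x))\<^sup>2)"
    by (rule Bochner_Integration.integrable_bound[OF assms(2)])
       (auto intro!: AE_I2 order_trans[OF assms(3)])
  then show ?thesis using assms(1) by (simp add: L2_def)
qed

text \<open>The parallelogram law with one of its two squares dropped.\<close>

lemma cmod_add_sq_le: "(cmod (a + b))\<^sup>2 \<le> 2 * (cmod a)\<^sup>2 + 2 * (cmod b)\<^sup>2"
proof -
  have "(cmod (a + b))\<^sup>2 + (cmod (a - b))\<^sup>2 = 2 * (cmod a)\<^sup>2 + 2 * (cmod b)\<^sup>2"
    unfolding cmod_power2 by (simp add: power2_eq_square algebra_simps)
  then show ?thesis using zero_le_power2[of "cmod (a - b)"] by linarith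
qed

lemma L2_cmult: "f \<in> L2 M \<Longrightarrow> (\<lambda>x. c * f x) \<in> L2 M"
  by (rule L2_dominated[where w = "\<lambda>x. (cmod c)\<^sup>2 * (cmod (f x))\<^sup>2"])
     (auto simp: L2_integrable norm_mult power_mult_distrib intro: borel_measurable_times L2_measurable)

lemma L2_add:
  assumes "f \<in> L2 M" "g \<in> L2 M"
  shows "(\<lambda>x. f x + g x) \<in> L2 M"
  by (rule L2_dominated[where w = "\<lambda>x. 2 * (cmod (f x))\<^sup>2 + 2 * (cmod (g x))\<^sup>2"])
     (use assms in \<open>auto simp: L2_integrable cmod_add_sq_le intro: borel_measurable_add L2_measurable\<close>)

lemma L2_diff:
  assumes "f \<in> L2 M" "g \<in> L2 M"
  shows "(\<lambda>x. f x - g x) \<in> L2 M"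
  using L2_add[OF assms(1) L2_cmult[OF assms(2), of "-1"]] by simp

lemma L2_zero: "(\<lambda>x. 0) \<in> L2 M"
  by (simp add: L2_def)

lemma L2_sum:
  assumes "\<And>i. i \<in> I \<Longrightarrow> f i \<in> L2 M"
  shows "(\<lambda>x. \<Sum>i\<in>I. f i x) \<in> L2 M"
  using assms by (induction I rule: infinite_finite_induct) (auto simp: L2_zero L2_add)

lemma L2_indicator:
  assumes "A \<in> sets M" "emeasure M A < \<infinity>"
  shows "(\<lambda>x. of_real (indicator A x)) \<in> L2 M"
proof (rule L2_dominated)
  show "integrable M (indicat_real A)"
    using assms by (simp add: integrable_indicator_iff)
qed (use assms in \<open>auto simp: indicator_def\<close>)

text \<open>Dominate the product by the sum of the squared moduli; the sharper factor 1/2 would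
  bring nothing for integrability.\<close>

lemma L2_integrable_prod:
  assumes "f \<in> L2 M" "g \<in> L2 M"
  shows "integrable M (\<lambda>x. f x * cnj (g x))"
proof -
  note [measurable] = assms[THEN L2_measurable]
  have "cmod a * cmod b \<le> (cmod a)\<^sup>2 + (cmod b)\<^sup>2" for a b :: complex
    using sum_squares_bound[of "cmod a" "cmod b"] mult_nonneg_nonneg[of "cmod a" "cmod b"]
      norm_ge_zero[of a] norm_ge_zero[of b] by linarith
  then have le: "norm (f x * cnj (g x)) \<le> (cmod (f x))\<^sup>2 + (cmod (g x))\<^sup>2" for x
    by (simp add: norm_mult)
  show ?thesis
    by (rule Bochner_Integration.integrable_bound[OF Bochner_Integration.integrable_add
          [OF assms[THEN L2_integrable]]]) (auto intro!: AE_I2 le simp del: norm_mult)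
qed

lemma L2_inner_add_left:
  assumes "f \<in> L2 M" "g \<in> L2 M" "h \<in> L2 M"
  shows "L2_inner M (\<lambda>x. f x + g x) h = L2_inner M f h + L2_inner M g h"
  unfolding L2_inner_def distrib_right
  by (intro Bochner_Integration.integral_add L2_integrable_prod assms)

lemma L2_inner_diff_left:
  assumes "f \<in> L2 M" "g \<in> L2 M" "h \<in> L2 M"
  shows "L2_inner M (\<lambda>x. f x - g x) h = L2_inner M f h - L2_inner M g h"
  unfolding L2_inner_def left_diff_distrib
  by (intro Bochner_Integration.integral_diff L2_integrable_prod assms)

lemma L2_inner_cmult_left: "L2_inner M (\<lambda>x. c * f x) g = c * L2_inner M f g"
  by (simp add: L2_inner_def mult.assoc)

lemma cnj_L2_inner: "cnj (L2_inner M f g) = L2_inner M g f"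
proof -
  have "cnj (L2_inner M f g) = (\<integral>x. cnj (f x * cnj (g x)) \<partial>M)"
    unfolding L2_inner_def by (rule Bochner_Integration.integral_cnj[symmetric])
  also have "\<dots> = L2_inner M g f"
    unfolding L2_inner_def by (simp only: complex_cnj_mult complex_cnj_cnj mult.commute)
  finally show ?thesis .
qed

lemma L2_inner_cong_AE:
  assumes "f \<in> L2 M" "f' \<in> L2 M" "g \<in> L2 M" "AE x in M. f x = f' x"
  shows "L2_inner M f g = L2_inner M f' g"
proof -
  note [measurable] = assms(1-3)[THEN L2_measurable]
  show ?thesis
    unfolding L2_inner_def by (rule integral_cong_AE) (use assms(4) in auto)
qed

lemma L2_norm_nonneg [simp]: "0 \<le> L2_norm M f"
  by (simp add: L2_norm_def)

lemma L2_norm_sq: "(L2_norm M f)\<^sup>2 = (\<integral>x. (cmod (f x))\<^sup>2 \<partial>M)"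
  by (simp add: L2_norm_def)

lemma L2_inner_self: "L2_inner M f f = of_real ((L2_norm M f)\<^sup>2)"
  unfolding L2_inner_def L2_norm_sq complex_norm_square[symmetric] integral_complex_of_real ..

lemma L2_eq_0_iff:
  assumes "f \<in> L2 M"
  shows "L2_inner M f f = 0 \<longleftrightarrow> (AE x in M. f x = 0)"
  using integral_nonneg_eq_0_iff_AE[OF L2_integrable[OF assms]]
  by (simp add: L2_inner_self L2_norm_sq)

lemma nn_integral_L2:
  assumes "f \<in> L2 M"
  shows "(\<integral>\<^sup>+x. ennreal ((cmod (f x))\<^sup>2) \<partial>M) = ennreal ((L2_norm M f)\<^sup>2)"
  by (simp add: L2_norm_sq nn_integral_eq_integral L2_integrable assms)

text \<open>The inequality for nonnegative integrals is applied to the moduli in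
  \<open>ennreal\<close>. All integrals involved are finite, so it descends to the reals.\<close>

lemma L2_Cauchy_Schwarz:
  assumes f: "f \<in> L2 M" and g: "g \<in> L2 M"
  shows "cmod (L2_inner M f g) \<le> L2_norm M f * L2_norm M g"
proof -
  note [measurable] = f[THEN L2_measurable] g[THEN L2_measurable]
  let ?I = "\<integral>x. cmod (f x) * cmod (g x) \<partial>M"
  have int: "integrable M (\<lambda>x. cmod (f x) * cmod (g x))"
    using integrable_norm[OF L2_integrable_prod[OF f g]] by (simp add: norm_mult)
  have "(\<integral>\<^sup>+x. ennreal (cmod (f x)) * ennreal (cmod (g x)) \<partial>M)\<^sup>2
      \<le> (\<integral>\<^sup>+x. (ennreal (cmod (f x)))\<^sup>2 \<partial>M) * (\<integral>\<^sup>+x. (ennreal (cmod (g x)))\<^sup>2 \<partial>M)"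
    by (rule Cauchy_Schwarz_nn_integral) auto
  moreover have "(\<integral>\<^sup>+x. ennreal (cmod (f x)) * ennreal (cmod (g x)) \<partial>M) = ennreal ?I"
    using nn_integral_eq_integral[OF int] by (simp add: ennreal_mult)
  ultimately have "ennreal (?I\<^sup>2) \<le> ennreal ((L2_norm M f * L2_norm M g)\<^sup>2)"
    by (simp add: ennreal_power nn_integral_L2 f g power_mult_distrib ennreal_mult)
  then have "?I \<le> L2_norm M f * L2_norm M g"
    by (subst (asm) ennreal_le_iff) (auto intro: power2_le_imp_le)
  moreover have "cmod (L2_inner M f g) \<le> ?I"
    unfolding L2_inner_def using integral_norm_bound[of M "\<lambda>x. f x * cnj (g x)"]
    by (simp add: norm_mult)
  ultimately show ?thesis by linarith
qed

lemma L2_norm_sq_add: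
  assumes "f \<in> L2 M" "g \<in> L2 M"
  shows "(L2_norm M (\<lambda>x. f x + g x))\<^sup>2 = (L2_norm M f)\<^sup>2 + 2 * Re (L2_inner M f g) + (L2_norm M g)\<^sup>2"
proof -
  have "(cmod (a + b))\<^sup>2 = (cmod a)\<^sup>2 + 2 * Re (a * cnj b) + (cmod b)\<^sup>2" for a b
    unfolding cmod_power2
    by (simp add: power2_eq_square algebra_simps)
  then have "(L2_norm M (\<lambda>x. f x + g x))\<^sup>2
      = (\<integral>x. (cmod (f x))\<^sup>2 + 2 * Re (f x * cnj (g x)) + (cmod (g x))\<^sup>2 \<partial>M)"
    unfolding L2_norm_sq by simp
  also have "\<dots> = (L2_norm M f)\<^sup>2 + 2 * Re (L2_inner M f g) + (L2_norm M g)\<^sup>2"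
    unfolding L2_norm_sq L2_inner_def integral_Re[OF L2_integrable_prod[OF assms], symmetric]
    using assms integrable_Re[OF L2_integrable_prod[OF assms]]
    by (simp add: L2_integrable del: times_complex.sel)
  finally show ?thesis .
qed

lemma L2_norm_sq_cmult: "(L2_norm M (\<lambda>x. c * f x))\<^sup>2 = (cmod c)\<^sup>2 * (L2_norm M f)\<^sup>2"
  by (simp add: L2_norm_sq norm_mult power_mult_distrib)

text \<open>Expand the norm for \<open>g\<close> and for \<open>-1 * g\<close>: the cross terms
  cancel.\<close>

lemma L2_norm_sq_parallelogram:
  assumes "f \<in> L2 M" "g \<in> L2 M"
  shows "(L2_norm M (\<lambda>x. f x + g x))\<^sup>2 + (L2_norm M (\<lambda>x. f x - g x))\<^sup>2
    = 2 * (L2_norm M f)\<^sup>2 + 2 * (L2_norm M g)\<^sup>2"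
proof -
  have "L2_inner M f (\<lambda>x. - 1 * g x) = - L2_inner M f g"
    by (simp add: L2_inner_def)
  then show ?thesis
    using L2_norm_sq_add[OF assms] L2_norm_sq_add[OF assms(1) L2_cmult[OF assms(2), of "-1"]]
      L2_norm_sq_cmult[of M "-1" g]
    by simp
qed

section \<open>Completeness and the Riesz representation theorem\<close>

text \<open>The weights \<open>2\<^sup>n\<close> turn square-summability of the increments into absolute summability.\<close>

lemma convergent_of_weighted_square_summable:
  fixes z :: "nat \<Rightarrow> complex"
  assumes "summable (\<lambda>n. 2 ^ n * (cmod (z (Suc n) - z n))\<^sup>2)"
  shows "convergent z"
proof -
  have "cmod (z (Suc n) - z n) \<le> (1/2) ^ n + 2 ^ n * (cmod (z (Suc n) - z n))\<^sup>2" for n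
  proof -
    let ?a = "cmod (z (Suc n) - z n)"
    \<comment> \<open>Arithmetic-geometric mean: expanding this square bounds \<open>2 * ?a\<close>
      by a geometric term plus the weighted square.\<close>
    have "0 \<le> (1/2)^n * (2 ^ n * ?a - 1)\<^sup>2" by simp
    also have "\<dots> = (1/2)^n + 2 ^ n * ?a\<^sup>2 - 2 * ?a"
      by (simp add: power2_eq_square field_simps flip: power_mult_distrib)
    finally show ?thesis using norm_ge_zero[of "z (Suc n) - z n"] by linarith
  qed
  then have "summable (\<lambda>n. z (Suc n) - z n)"
    by (intro summable_comparison_test[OF _ summable_add[OF summable_geometric[of "1/2::real"] assms]])
       auto
  then have "convergent (\<lambda>n. \<Sum>i<n. z (Suc i) - z i)"
    using summable_iff_convergent by blast
  then have "convergent (\<lambda>n. z n - z 0)"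
    by (simp add: sum_lessThan_telescope)
  then show ?thesis
    using convergent_diff_const_right_iff by blast
qed

text \<open>The rate \<open>4\<^sup>-\<^sup>n\<close> makes the whole sequence converge almost everywhere, not only a subsequence.\<close>

lemma L2_complete_fast:
  fixes u :: "nat \<Rightarrow> 'a \<Rightarrow> complex"
  assumes u: "\<And>n. u n \<in> L2 M"
    and fast: "\<And>m n. n \<le> m \<Longrightarrow> (L2_norm M (\<lambda>x. u m x - u n x))\<^sup>2 \<le> K * (1/4) ^ n"
  shows "\<exists>h\<in>L2 M. \<forall>n. (L2_norm M (\<lambda>x. u n x - h x))\<^sup>2 \<le> K * (1/4) ^ n"
proof -
  note [measurable] = u[THEN L2_measurable]
  \<comment> \<open>\<open>lim\<close> is total and measurable; its arbitrary value at points of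
    divergence is harmless, as these form a null set.\<close>
  define h where "h x = lim (\<lambda>n. u n x)" for x
  have [measurable]: "h \<in> borel_measurable M"
    unfolding h_def by measurable
  have K: "0 \<le> K" using order_trans[OF _ fast[of 0 0]] by simp
  let ?s = "\<lambda>n x. 2 ^ n * (cmod (u (Suc n) x - u n x))\<^sup>2"
  \<comment> \<open>Weight times rate is \<open>2 ^ n * (1/4) ^ n = (1/2) ^ n\<close>, still
    summable. So the weighted series has finite integral and converges almost everywhere.\<close>
  have "(\<integral>\<^sup>+x. (\<Sum>n. ennreal (?s n x)) \<partial>M) = (\<Sum>n. \<integral>\<^sup>+x. ennreal (?s n x) \<partial>M)"
    by (rule nn_integral_suminf) auto
  also have "\<dots> \<le> (\<Sum>n. ennreal (K * (1/2) ^ n))"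
  proof (rule suminf_le)
    fix n
    have "(\<integral>\<^sup>+x. ennreal (?s n x) \<partial>M) = ennreal (2 ^ n * (L2_norm M (\<lambda>x. u (Suc n) x - u n x))\<^sup>2)"
      by (simp add: ennreal_mult nn_integral_cmult nn_integral_L2 L2_diff u)
    also have "\<dots> \<le> ennreal (2 ^ n * (K * (1/4) ^ n))"
      by (intro ennreal_leI mult_left_mono fast) auto
    also have "2 ^ n * (K * (1/4) ^ n) = K * (1/2) ^ n"
      by (simp add: field_simps flip: power_mult_distrib)
    finally show "(\<integral>\<^sup>+x. ennreal (?s n x) \<partial>M) \<le> ennreal (K * (1/2) ^ n)" .
  qed auto
  also have "\<dots> = ennreal (\<Sum>n. K * (1/2) ^ n)"
    using K by (intro suminf_ennreal2 summable_mult summable_geometric) auto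
  finally have "(\<integral>\<^sup>+x. (\<Sum>n. ennreal (?s n x)) \<partial>M) \<noteq> \<infinity>"
    by (auto simp: top_unique)
  then have "AE x in M. (\<Sum>n. ennreal (?s n x)) \<noteq> \<infinity>"
    by (intro nn_integral_noteq_infinite) auto
  then have lim: "AE x in M. (\<lambda>n. u n x) \<longlonglongrightarrow> h x"
  proof eventually_elim
    case (elim x)
    then have "summable (\<lambda>n. ?s n x)"
      by (intro summable_suminf_not_top) auto
    then show ?case
      unfolding h_def using convergent_of_weighted_square_summable by (simp add: convergent_LIMSEQ_iff)
  qed
  \<comment> \<open>Fatou's lemma in \<open>m\<close> for fixed \<open>n\<close>;
    \<open>fast\<close> bounds the integrals as soon as \<open>n \<le> m\<close>.\<close>
  have dist: "(\<integral>\<^sup>+x. ennreal ((cmod (u n x - h x))\<^sup>2) \<partial>M) \<le> ennreal (K * (1/4) ^ n)" for n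
  proof -
    have "AE x in M. ennreal ((cmod (u n x - h x))\<^sup>2)
        = liminf (\<lambda>m. ennreal ((cmod (u m x - u n x))\<^sup>2))"
      using lim
    proof eventually_elim
      case (elim x)
      then have "(\<lambda>m. ennreal ((cmod (u m x - u n x))\<^sup>2)) \<longlonglongrightarrow> ennreal ((cmod (h x - u n x))\<^sup>2)"
        by (intro tendsto_intros)
      from lim_imp_Liminf[OF _ this] show ?case
        by (simp add: norm_minus_commute)
    qed
    then have "(\<integral>\<^sup>+x. ennreal ((cmod (u n x - h x))\<^sup>2) \<partial>M)
        = (\<integral>\<^sup>+x. liminf (\<lambda>m. ennreal ((cmod (u m x - u n x))\<^sup>2)) \<partial>M)"
      by (rule nn_integral_cong_AE)
    also have "\<dots> \<le> liminf (\<lambda>m. \<integral>\<^sup>+x. ennreal ((cmod (u m x - u n x))\<^sup>2) \<partial>M)"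
      by (rule nn_integral_liminf) auto
    also have "\<dots> \<le> limsup (\<lambda>m. \<integral>\<^sup>+x. ennreal ((cmod (u m x - u n x))\<^sup>2) \<partial>M)"
      by (rule Liminf_le_Limsup) auto
    also have "\<dots> \<le> ennreal (K * (1/4) ^ n)"
      by (rule Limsup_bounded)
         (auto intro!: eventually_sequentiallyI[of n] ennreal_leI fast simp: nn_integral_L2 L2_diff u)
    finally show ?thesis .
  qed
  have diff: "(\<lambda>x. u n x - h x) \<in> L2 M" for n
    using dist[of n] unfolding L2_def
    by (auto intro!: integrableI_bounded simp: less_top[symmetric] top_unique)
  \<comment> \<open>Here \<open>h\<close> is written as \<open>u 0 - (u 0 - h)\<close>.\<close>
  have "h \<in> L2 M"
    using L2_diff[OF u[of 0] diff[of 0]] by simp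
  moreover have "(L2_norm M (\<lambda>x. u n x - h x))\<^sup>2 \<le> K * (1/4) ^ n" for n
    using dist[of n] K by (simp add: nn_integral_L2 diff)
  ultimately show ?thesis by blast
qed

text \<open>Minimise \<open>J f = \<parallel>f\<parallel>\<^sup>2 - 2 Re (l f)\<close>: the parallelogram law makes minimising sequences Cauchy,
  and vanishing of the first variation at the limit is the representation.\<close>

lemma L2_Riesz_representation:
  fixes l :: "('a \<Rightarrow> complex) \<Rightarrow> complex"
  assumes add: "\<And>f g. f \<in> L2 M \<Longrightarrow> g \<in> L2 M \<Longrightarrow> l (\<lambda>x. f x + g x) = l f + l g"
    and scale: "\<And>c f. f \<in> L2 M \<Longrightarrow> l (\<lambda>x. c * f x) = c * l f"
    and bound: "\<And>f. f \<in> L2 M \<Longrightarrow> cmod (l f) \<le> C * L2_norm M f"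
  shows "\<exists>h\<in>L2 M. \<forall>f\<in>L2 M. l f = L2_inner M f h"
proof -
  define J where "J f = (L2_norm M f)\<^sup>2 - 2 * Re (l f)" for f
  define d where "d = Inf (J ` L2 M)"
  \<comment> \<open>With \<open>N\<close> the norm of \<open>f\<close>, \<open>J f\<close> is at
    least \<open>N^2 - 2*C*N = (N - C)^2 - C^2\<close>.\<close>
  have "- C\<^sup>2 \<le> J f" if "f \<in> L2 M" for f
  proof -
    have "Re (l f) \<le> C * L2_norm M f"
      using bound[OF that] complex_Re_le_cmod[of "l f"] by linarith
    moreover have "0 \<le> (L2_norm M f - C)\<^sup>2" by simp
    ultimately show ?thesis
      unfolding J_def by (simp add: power2_diff mult.commute)
  qed
  then have bdd: "bdd_below (J ` L2 M)"
    by (intro bdd_belowI2)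
  have d_le: "d \<le> J f" if "f \<in> L2 M" for f
    unfolding d_def using bdd that by (rule cINF_lower)
  \<comment> \<open>The precision \<open>(1/4) ^ n\<close> is chosen to produce the rate that
    \<open>L2_complete_fast\<close> asks for.\<close>
  have "\<exists>f\<in>L2 M. J f < d + (1/4) ^ n" for n :: nat
  proof (rule ccontr)
    assume "\<not> ?thesis"
    then have "d + (1/4) ^ n \<le> d"
      unfolding d_def[symmetric] using L2_zero
      by (subst (2) d_def) (intro cINF_greatest, auto simp: not_less)
    then show False using zero_less_power[of "1/4::real" n] by linarith
  qed
  then obtain u where u: "\<And>n. u n \<in> L2 M" and Ju: "\<And>n. J (u n) < d + (1/4) ^ n"
    by metis
  \<comment> \<open>The midpoint of \<open>f\<close> and \<open>g\<close> also has \<open>J\<close>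
    at least \<open>d\<close>; the parallelogram law turns this into a bound on their
    distance.\<close>
  have dist: "(L2_norm M (\<lambda>x. f x - g x))\<^sup>2 \<le> 2 * (J f + J g - 2 * d)"
    if fg: "f \<in> L2 M" "g \<in> L2 M" for f g
  proof -
    have fg': "(\<lambda>x. f x + g x) \<in> L2 M" using fg by (rule L2_add)
    have "d \<le> J (\<lambda>x. 1/2 * (f x + g x))"
      by (rule d_le[OF L2_cmult[OF fg']])
    also have "\<dots> = (L2_norm M (\<lambda>x. f x + g x))\<^sup>2 / 4 - Re (l f + l g)"
      unfolding J_def L2_norm_sq_cmult scale[OF fg'] add[OF fg]
      by (simp add: power2_eq_square field_simps)
    finally show ?thesis
      using L2_norm_sq_parallelogram[OF fg] unfolding J_def by simp
  qed
  \<comment> \<open>Both excesses over \<open>d\<close> are below \<open>(1/4) ^ n\<close>, and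
    \<open>dist\<close> doubles their sum, whence the factor 4.\<close>
  have "(L2_norm M (\<lambda>x. u m x - u n x))\<^sup>2 \<le> 4 * (1/4) ^ n" if "n \<le> m" for m n
  proof -
    define e :: "nat \<Rightarrow> real" where "e k = (1/4) ^ k" for k
    have "e m \<le> e n" unfolding e_def using that by (intro power_decreasing) auto
    then show ?thesis
      using dist[OF u[of m] u[of n]] Ju[of m, folded e_def] Ju[of n, folded e_def]
      unfolding e_def[symmetric] by argo
  qed
  from L2_complete_fast[of u M, OF u this] obtain h
    where h: "h \<in> L2 M" and uh: "\<And>n. (L2_norm M (\<lambda>x. u n x - h x))\<^sup>2 \<le> 4 * (1/4) ^ n"
    by auto
  \<comment> \<open>Cauchy-Schwarz together with the square root of the rate in
    \<open>uh\<close>.\<close>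
  have tendsto: "(\<lambda>n. L2_inner M (u n) f) \<longlonglongrightarrow> L2_inner M h f" if f: "f \<in> L2 M" for f
  proof (rule LIM_zero_cancel, rule Lim_null_comparison)
    show "\<forall>\<^sub>F n in sequentially. norm (L2_inner M (u n) f - L2_inner M h f)
        \<le> 2 * (1/2) ^ n * L2_norm M f"
    proof (intro always_eventually allI)
      fix n
      have "norm (L2_inner M (u n) f - L2_inner M h f) \<le> L2_norm M (\<lambda>x. u n x - h x) * L2_norm M f"
        unfolding L2_inner_diff_left[OF u h f, symmetric]
        by (rule L2_Cauchy_Schwarz[OF L2_diff[OF u h] f])
      also have "L2_norm M (\<lambda>x. u n x - h x) \<le> 2 * (1/2) ^ n"
      proof (rule power2_le_imp_le)
        show "(L2_norm M (\<lambda>x. u n x - h x))\<^sup>2 \<le> (2 * (1/2) ^ n)\<^sup>2"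
          using uh[of n] by (simp add: power2_eq_square flip: power_mult_distrib)
      qed simp
      finally show "norm (L2_inner M (u n) f - L2_inner M h f) \<le> 2 * (1/2) ^ n * L2_norm M f"
        by (simp add: mult_right_mono)
    qed
    have "(\<lambda>n. 2 * (1/2::real) ^ n * L2_norm M f) \<longlonglongrightarrow> 2 * 0 * L2_norm M f"
      by (intro tendsto_intros LIMSEQ_power_zero) auto
    then show "(\<lambda>n. 2 * (1/2::real) ^ n * L2_norm M f) \<longlonglongrightarrow> 0" by simp
  qed
  have Re_eq: "Re (l f) = Re (L2_inner M h f)" if f: "f \<in> L2 M" for f
  proof -
    define b where "b = Re (L2_inner M h f) - Re (l f)"
    \<comment> \<open>First variation at \<open>h\<close> in direction \<open>f\<close>. The
      near-minimiser \<open>u n\<close> is perturbed by \<open>t * f\<close>, which lowers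
      \<open>J\<close> by at most \<open>(1/4) ^ n\<close>; then \<open>n\<close> tends to
      infinity.\<close>
    have var: "0 \<le> 2 * t * b + t\<^sup>2 * (L2_norm M f)\<^sup>2" for t :: real
    proof -
      have "- ((1/4) ^ n) \<le> 2 * t * (Re (L2_inner M (u n) f) - Re (l f)) + t\<^sup>2 * (L2_norm M f)\<^sup>2" for n
      proof -
        have tf: "(\<lambda>x. of_real t * f x) \<in> L2 M" using f by (rule L2_cmult)
        have "cnj (L2_inner M (\<lambda>x. of_real t * f x) (u n)) = of_real t * L2_inner M (u n) f"
          unfolding L2_inner_cmult_left by (simp add: cnj_L2_inner)
        then have "L2_inner M (u n) (\<lambda>x. of_real t * f x) = of_real t * L2_inner M (u n) f"
          by (simp add: cnj_L2_inner)
        then have "J (\<lambda>x. u n x + of_real t * f x)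
            = J (u n) + 2 * t * (Re (L2_inner M (u n) f) - Re (l f)) + t\<^sup>2 * (L2_norm M f)\<^sup>2"
          unfolding J_def L2_norm_sq_add[OF u tf] L2_norm_sq_cmult add[OF u tf] scale[OF f]
          by (simp add: algebra_simps)
        then show ?thesis
          using d_le[OF L2_add[OF u[of n] tf]] Ju[of n] by linarith
      qed
      moreover have "(\<lambda>n. 2 * t * (Re (L2_inner M (u n) f) - Re (l f)) + t\<^sup>2 * (L2_norm M f)\<^sup>2)
          \<longlonglongrightarrow> 2 * t * b + t\<^sup>2 * (L2_norm M f)\<^sup>2"
        unfolding b_def by (intro tendsto_intros tendsto[OF f])
      moreover have "(\<lambda>n. - ((1/4::real) ^ n)) \<longlonglongrightarrow> - 0"
        by (intro tendsto_minus LIMSEQ_power_zero) auto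
      ultimately show ?thesis
        by (metis (no_types, lifting) LIMSEQ_le minus_zero)
    qed
    \<comment> \<open>The minimum over \<open>t\<close> would divide by the squared norm, which may
      vanish; adding 1 avoids this. At \<open>t = - b / a\<close> the variation is a negative
      multiple of \<open>b^2\<close>, so \<open>b = 0\<close>.\<close>
    define a where "a = (L2_norm M f)\<^sup>2 + 1"
    have a: "0 < a" unfolding a_def using zero_le_power2[of "L2_norm M f"] by linarith
    have "0 \<le> a\<^sup>2 * (2 * (- b / a) * b + (- b / a)\<^sup>2 * (L2_norm M f)\<^sup>2)"
      using var[of "- b / a"] by simp
    also have "\<dots> = b\<^sup>2 * (L2_norm M f)\<^sup>2 - 2 * b\<^sup>2 * a"
      using a by (simp add: power2_eq_square field_simps)
    also have "\<dots> = - (b\<^sup>2 * (a + 1))"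
      by (simp add: a_def algebra_simps)
    finally have "b = 0"
      using a by (simp add: mult_le_0_iff)
    then show ?thesis by (simp add: b_def)
  qed
  have "l f = L2_inner M f h" if f: "f \<in> L2 M" for f
  proof -
    \<comment> \<open>Swapping the arguments conjugates the inner product and keeps its real part.
      Applied to \<open>\<i> * f\<close>, the same identity yields the imaginary parts.\<close>
    have inner: "Re (l g) = Re (L2_inner M g h)" if "g \<in> L2 M" for g
      using Re_eq[OF that] cnj_L2_inner[of M g h] by (metis complex_cnj(1) complex_surj complex.sel(1))
    have "Re (\<i> * l f) = Re (\<i> * L2_inner M f h)"
      using inner[OF L2_cmult[OF f, of \<i>]] unfolding scale[OF f] L2_inner_cmult_left .
    then show ?thesis
      using inner[OF f] by (simp add: complex_eq_iff)
  qed
  with h show ?thesis by blast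
qed

section \<open>Existence of adjoints and adjoints of powers\<close>

text \<open>For each \<open>g\<close>, represent the functional sending \<open>f\<close> to the
  inner product of \<open>T f\<close> with \<open>g\<close>. \<open>T\<close> is linear only almost
  everywhere, but the integral turns this into exact linearity of the functional.\<close>

lemma bounded_operator_L2_adjoint:
  assumes "bounded_operator_L2 M T"
  shows "is_adjoint_L2 M T (adjoint_L2 M T)"
proof -
  from assms obtain C where T: "\<And>f. f \<in> L2 M \<Longrightarrow> T f \<in> L2 M"
    and add: "\<And>f g. f \<in> L2 M \<Longrightarrow> g \<in> L2 M \<Longrightarrow> AE x in M. T (\<lambda>y. f y + g y) x = T f x + T g x"
    and scale: "\<And>c f. f \<in> L2 M \<Longrightarrow> AE x in M. T (\<lambda>y. c * f y) x = c * T f x"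
    and bound: "\<And>f. f \<in> L2 M \<Longrightarrow> L2_norm M (T f) \<le> C * L2_norm M f"
    unfolding bounded_operator_L2_def by blast
  have "\<exists>h\<in>L2 M. \<forall>f\<in>L2 M. L2_inner M (T f) g = L2_inner M f h" if g: "g \<in> L2 M" for g
  proof (rule L2_Riesz_representation)
    fix f f' assume "f \<in> L2 M" "f' \<in> L2 M"
    then show "L2_inner M (T (\<lambda>x. f x + f' x)) g = L2_inner M (T f) g + L2_inner M (T f') g"
      using L2_inner_cong_AE[OF _ _ g add] L2_inner_add_left[OF T T g] by (simp add: T L2_add)
  next
    fix c f assume "f \<in> L2 M"
    then show "L2_inner M (T (\<lambda>x. c * f x)) g = c * L2_inner M (T f) g"
      using L2_inner_cong_AE[OF _ _ g scale] L2_inner_cmult_left by (simp add: T L2_cmult)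
  next
    fix f assume f: "f \<in> L2 M"
    have "cmod (L2_inner M (T f) g) \<le> L2_norm M (T f) * L2_norm M g"
      by (rule L2_Cauchy_Schwarz[OF T[OF f] g])
    also have "\<dots> \<le> C * L2_norm M f * L2_norm M g"
      by (rule mult_right_mono[OF bound[OF f]]) simp
    finally show "cmod (L2_inner M (T f) g) \<le> (C * L2_norm M g) * L2_norm M f"
      by (simp add: ac_simps)
  qed
  then obtain S where "\<And>g. g \<in> L2 M \<Longrightarrow> S g \<in> L2 M \<and> (\<forall>f\<in>L2 M. L2_inner M (T f) g = L2_inner M f (S g))"
    by metis
  then have "is_adjoint_L2 M T S"
    unfolding is_adjoint_L2_def by blast
  then show ?thesis
    unfolding adjoint_L2_def by (rule someI[of "is_adjoint_L2 M T"])
qed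

lemma funpow_in_L2: "(\<And>f. f \<in> L2 M \<Longrightarrow> T f \<in> L2 M) \<Longrightarrow> f \<in> L2 M \<Longrightarrow> (T ^^ k) f \<in> L2 M"
  by (induction k) auto

text \<open>One factor crosses at a time, so \<open>g\<close> must vary in the induction: it becomes
  \<open>S g\<close>.\<close>

lemma is_adjoint_L2_funpow:
  assumes T: "\<And>f. f \<in> L2 M \<Longrightarrow> T f \<in> L2 M" and TS: "is_adjoint_L2 M T S"
    and "f \<in> L2 M" "g \<in> L2 M"
  shows "L2_inner M ((T ^^ k) f) g = L2_inner M f ((S ^^ k) g)"
  using \<open>g \<in> L2 M\<close>
proof (induction k arbitrary: g)
  case (Suc k)
  have "L2_inner M ((T ^^ Suc k) f) g = L2_inner M ((T ^^ k) f) (S g)"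
    using TS Suc.prems funpow_in_L2[OF T \<open>f \<in> L2 M\<close>] by (simp add: is_adjoint_L2_def)
  also have "\<dots> = L2_inner M f ((S ^^ k) (S g))"
    using TS Suc.prems by (intro Suc.IH) (simp add: is_adjoint_L2_def)
  finally show ?case by (simp only: funpow_Suc_right o_def)
qed simp

section \<open>Semifiniteness of the measure\<close>

text \<open>Otherwise \<open>1\<close> and \<open>1 + 1\<^sub>A\<close> would both be densities of \<open>M\<close> with respect to itself.\<close>

lemma unique_RN_deriv_imp_semifinite:
  assumes uniq: "has_unique_RN_deriv M M"
    and A: "A \<in> sets M" "emeasure M A \<noteq> 0"
  shows "\<exists>B\<in>sets M. B \<subseteq> A \<and> 0 < emeasure M B \<and> emeasure M B < \<infinity>"
proof (rule ccontr)
  assume none: "\<not> ?thesis"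
  have inf: "emeasure M B = \<infinity>" if "B \<in> sets M" "B \<subseteq> A" "emeasure M B \<noteq> 0" for B
    using none that by (auto simp: zero_less_iff_neq_zero less_top[symmetric])
  obtain f where f: "\<And>g. g \<in> borel_measurable M \<Longrightarrow> density M g = M \<Longrightarrow> AE x in M. g x = (f x :: ennreal)"
    using uniq unfolding has_unique_RN_deriv_def by blast
  have "density M (\<lambda>x. 1 + indicator A x :: ennreal) = M"
  proof (rule measure_eqI)
    fix B assume "B \<in> sets (density M (\<lambda>x. 1 + indicator A x :: ennreal))"
    then have B: "B \<in> sets M" by simp
    have "emeasure (density M (\<lambda>x. 1 + indicator A x :: ennreal)) B
        = (\<integral>\<^sup>+x. indicator B x + indicator (A \<inter> B) x \<partial>M)"
      using A B by (simp add: emeasure_density distrib_right indicator_inter_arith)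
    also have "\<dots> = emeasure M B + emeasure M (A \<inter> B)"
      using A B by (simp add: nn_integral_add)
    \<comment> \<open>Either the added part \<open>A \<inter> B\<close> is null, or by
      \<open>inf\<close> it is infinite and then \<open>B\<close> has infinite measure
      already.\<close>
    also have "\<dots> = emeasure M B"
    proof (cases "emeasure M (A \<inter> B) = 0")
      case False
      then have "emeasure M (A \<inter> B) = \<infinity>" using A B by (intro inf) auto
      moreover have "emeasure M (A \<inter> B) \<le> emeasure M B" using B by (intro emeasure_mono) auto
      ultimately show ?thesis by (simp add: top_unique)
    qed simp
    finally show "emeasure (density M (\<lambda>x. 1 + indicator A x :: ennreal)) B = emeasure M B" .
  qed simp
  then have "AE x in M. 1 + indicator A x = f x"
    using A by (intro f) auto
  moreover have "AE x in M. 1 = f x"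
    by (intro f) (auto simp: density_1)
  ultimately have "AE x in M. x \<notin> A"
  proof eventually_elim
    case (elim x)
    then have "1 + indicator A x = (1 :: ennreal)" by simp
    then show ?case by (auto simp: indicator_def split: if_splits)
  qed
  then show False
    using A by (simp add: AE_iff_null_sets[symmetric] null_sets_def)
qed

section \<open>Powers of the composition operator and the derivatives \<open>h_RN\<close>\<close>

lemma composition_operator_funpow: "(composition_operator \<phi> ^^ k) f = f \<circ> (\<phi> ^^ k)"
proof (induction k)
  case (Suc k)
  then show ?case
    unfolding funpow_Suc_right[of k \<phi>] by (simp add: composition_operator_def comp_assoc)
qed simp

locale bounded_composition_operator =
  fixes M :: "'a measure" and \<phi> :: "'a \<Rightarrow> 'a"
  assumes measurable_\<phi> [measurable]: "\<phi> \<in> measurable M M"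
    and RN: "RN_derivs_well_defined M \<phi>"
    and bounded: "bounded_operator_L2 M (composition_operator \<phi>)"
begin

abbreviation "T \<equiv> composition_operator \<phi>"
abbreviation "S \<equiv> adjoint_L2 M T"
text \<open>By \<open>h_RN_finite\<close>, passing to real values alters the derivative on a null
  set only.\<close>

abbreviation "h n x \<equiv> enn2real (h_RN M \<phi> n x)"

lemma T_in_L2: "f \<in> L2 M \<Longrightarrow> T f \<in> L2 M"
  using bounded by (simp add: bounded_operator_L2_def)

lemma adjoint: "is_adjoint_L2 M T S"
  using bounded by (rule bounded_operator_L2_adjoint)

lemma S_in_L2: "f \<in> L2 M \<Longrightarrow> S f \<in> L2 M"
  using adjoint by (simp add: is_adjoint_L2_def)

lemma T_funpow_in_L2: "f \<in> L2 M \<Longrightarrow> (T ^^ k) f \<in> L2 M"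
  by (rule funpow_in_L2[OF T_in_L2])

lemma S_funpow_in_L2: "f \<in> L2 M \<Longrightarrow> (S ^^ k) f \<in> L2 M"
  by (rule funpow_in_L2[OF S_in_L2])

text \<open>The case \<open>n = 0\<close> of \<open>RN\<close>, where the image measure is
  \<open>M\<close> itself.\<close>

lemma semifinite:
  assumes "A \<in> sets M" "emeasure M A \<noteq> 0"
  obtains B where "B \<in> sets M" "B \<subseteq> A" "0 < emeasure M B" "emeasure M B < \<infinity>"
proof -
  have "distr M M (\<phi> ^^ 0) = M" by (simp add: id_def distr_id)
  then have "has_unique_RN_deriv M M"
    using RN unfolding RN_derivs_well_defined_def by metis
  from unique_RN_deriv_imp_semifinite[OF this assms] that show ?thesis by blast
qed

lemma h_RN_measurable [measurable]: "h_RN M \<phi> n \<in> borel_measurable M"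
  by (simp add: h_RN_def)

text \<open>\<open>RN_deriv\<close> is a density whenever one exists, and \<open>RN\<close> supplies
  existence.\<close>

lemma density_h_RN: "density M (h_RN M \<phi> n) = distr M M (\<phi> ^^ n)"
proof (cases "n = 0")
  case True
  then show ?thesis by (simp add: h_RN_def density_1 id_def distr_id)
next
  case False
  obtain f where "f \<in> borel_measurable M" "density M f = distr M M (\<phi> ^^ n)"
    using RN unfolding RN_derivs_well_defined_def has_unique_RN_deriv_def by blast
  from RN_derivI[OF this] show ?thesis using False by (simp add: h_RN_def)
qed

text \<open>Since \<open>T\<^sup>n\<close> maps the indicator of a set of finite measure into \<open>L\<^sup>2\<close>, the measure
  \<open>\<mu> \<circ> \<phi>\<^sup>-\<^sup>n\<close> is finite on that set, so \<open>h\<^sub>n = \<infinity>\<close> has no subset of finite positive measure.\<close>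

lemma h_RN_finite: "AE x in M. h_RN M \<phi> n x \<noteq> \<infinity>"
proof (rule ccontr)
  note [measurable] = measurable_funpow[OF measurable_\<phi>]
  let ?A = "{x \<in> space M. h_RN M \<phi> n x = \<infinity>}"
  assume "\<not> ?thesis"
  then have "emeasure M ?A \<noteq> 0"
    by (subst (asm) AE_iff_measurable[OF _ refl]) auto
  then obtain B where B: "B \<in> sets M" "B \<subseteq> ?A" "0 < emeasure M B" "emeasure M B < \<infinity>"
    by (rule semifinite[rotated]) auto
  note [measurable] = B(1)
  have "(T ^^ n) (\<lambda>x. of_real (indicator B x)) \<in> L2 M"
    by (intro T_funpow_in_L2 L2_indicator B)
  then have "integrable M (\<lambda>x. (cmod (of_real (indicator B ((\<phi> ^^ n) x))))\<^sup>2)"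
    using L2_integrable by (fastforce simp: composition_operator_funpow)
  also have "(\<lambda>x. (cmod (of_real (indicator B ((\<phi> ^^ n) x))))\<^sup>2) = indicat_real ((\<phi> ^^ n) -` B)"
    by (auto simp: indicator_def)
  finally have "integrable M (indicat_real ((\<phi> ^^ n) -` B))" .
  then have "emeasure M ((\<phi> ^^ n) -` B \<inter> space M) < \<infinity>"
    by (simp add: integrable_indicator_iff)
  \<comment> \<open>The same measure is computed through the density, which is infinite on all of
    \<open>B\<close>; since \<open>B\<close> is not null, the result is infinite.\<close>
  moreover have "emeasure M ((\<phi> ^^ n) -` B \<inter> space M) = emeasure (density M (h_RN M \<phi> n)) B"
    by (simp add: density_h_RN emeasure_distr)
  moreover have "\<dots> = (\<integral>\<^sup>+x. h_RN M \<phi> n x * indicator B x \<partial>M)"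
    by (simp add: emeasure_density)
  moreover have "\<dots> = (\<integral>\<^sup>+x. \<infinity> * indicator B x \<partial>M)"
    using B(2) by (intro nn_integral_cong) (auto simp: indicator_def)
  moreover have "\<dots> = \<infinity>"
    using B(3) by (subst nn_integral_cmult_indicator) (auto simp: ennreal_top_mult)
  ultimately show False by simp
qed

text \<open>Change of variables along \<open>\<phi> ^^ n\<close>. No bound on \<open>h n\<close> is
  at hand, so integrability is carried over from the product of \<open>(T ^^ n) f\<close> and the
  conjugate of \<open>(T ^^ n) g\<close>.\<close>

lemma T_funpow_inner:
  assumes "f \<in> L2 M" "g \<in> L2 M"
  shows "integrable M (\<lambda>x. of_real (h n x) * (f x * cnj (g x)))"
    and "L2_inner M ((T ^^ n) f) ((T ^^ n) g) = (\<integral>x. of_real (h n x) * (f x * cnj (g x)) \<partial>M)"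
proof -
  note [measurable] = measurable_funpow[OF measurable_\<phi>] assms[THEN L2_measurable]
  let ?F = "\<lambda>x. f x * cnj (g x)"
  have "density M (\<lambda>x. ennreal (h n x)) = density M (h_RN M \<phi> n)"
    using h_RN_finite[of n] by (intro density_cong) (auto simp: less_top)
  then have dens: "density M (\<lambda>x. ennreal (h n x)) = distr M M (\<phi> ^^ n)"
    by (simp add: density_h_RN)
  have "integrable M (\<lambda>x. ?F ((\<phi> ^^ n) x))"
    using L2_integrable_prod[OF assms[THEN T_funpow_in_L2], of n n]
    by (simp add: composition_operator_funpow)
  then have "integrable (density M (\<lambda>x. ennreal (h n x))) ?F"
    unfolding dens by (subst integrable_distr_eq) auto
  then show "integrable M (\<lambda>x. of_real (h n x) * ?F x)"
    by (subst (asm) integrable_density) (auto simp: scaleR_conv_of_real)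
  have "L2_inner M ((T ^^ n) f) ((T ^^ n) g) = integral\<^sup>L (distr M M (\<phi> ^^ n)) ?F"
    by (simp add: L2_inner_def composition_operator_funpow integral_distr)
  also have "\<dots> = (\<integral>x. of_real (h n x) * ?F x \<partial>M)"
    unfolding dens[symmetric] by (subst integral_density) (auto simp: scaleR_conv_of_real)
  finally show "L2_inner M ((T ^^ n) f) ((T ^^ n) g) = (\<integral>x. of_real (h n x) * ?F x \<partial>M)" .
qed

section \<open>Defect operators as multiplication operators\<close>

text \<open>If \<open>Q\<close> vanishes, test it on indicators of sets of finite positive measure
  on which \<open>H\<close> has constant sign; semifiniteness provides them. If \<open>H\<close>
  vanishes, pair \<open>Q g\<close> with itself.\<close>

lemma operator_zero_iff_symbol_zero:
  fixes H :: "'a \<Rightarrow> real"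
  assumes [measurable]: "H \<in> borel_measurable M"
    and Q: "\<And>g. g \<in> L2 M \<Longrightarrow> Q g \<in> L2 M"
    and inner: "\<And>f g. f \<in> L2 M \<Longrightarrow> g \<in> L2 M \<Longrightarrow> L2_inner M f (Q g) = (\<integral>x. of_real (H x) * (f x * cnj (g x)) \<partial>M)"
    and int: "\<And>f g. f \<in> L2 M \<Longrightarrow> g \<in> L2 M \<Longrightarrow> integrable M (\<lambda>x. of_real (H x) * (f x * cnj (g x)))"
  shows "(\<forall>g\<in>L2 M. AE x in M. Q g x = 0) \<longleftrightarrow> (AE x in M. H x = 0)"
proof
  assume zero: "\<forall>g\<in>L2 M. AE x in M. Q g x = 0"
  \<comment> \<open>The factor \<open>s\<close> treats both signs of \<open>H\<close> at once; it is
    taken to be 1 and -1 below.\<close>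
  have "AE x in M. \<not> 0 < s * H x" if "s \<noteq> 0" for s
  proof (rule ccontr)
    let ?A = "{x \<in> space M. 0 < s * H x}"
    assume "\<not> ?thesis"
    then have "emeasure M ?A \<noteq> 0"
      by (subst (asm) AE_iff_measurable[OF _ refl]) auto
    then obtain B where B: "B \<in> sets M" "B \<subseteq> ?A" "0 < emeasure M B" "emeasure M B < \<infinity>"
      by (rule semifinite[rotated]) auto
    note [measurable] = B(1)
    let ?e = "\<lambda>x. complex_of_real (indicator B x)"
    have 1: "?e \<in> L2 M" by (rule L2_indicator) (use B in auto)
    have eq: "(\<lambda>x. of_real (H x) * (?e x * cnj (?e x))) = (\<lambda>x. complex_of_real (H x * indicator B x))"
      by (auto simp: indicator_def)
    have "L2_inner M ?e (Q ?e) = L2_inner M ?e (\<lambda>x. 0)"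
      using L2_inner_cong_AE[OF Q[OF 1] L2_zero 1] zero 1 cnj_L2_inner by metis
    then have "(\<integral>x. complex_of_real (H x * indicator B x) \<partial>M) = 0"
      unfolding inner[OF 1 1] eq by (simp add: L2_inner_def)
    then have "(\<integral>x. s * (H x * indicator B x) \<partial>M) = 0"
      by (simp del: of_real_mult)
    moreover have "integrable M (\<lambda>x. H x * indicator B x)"
      using int[OF 1 1] unfolding eq complex_of_real_integrable_eq .
    moreover have "0 \<le> s * (H x * indicator B x)" for x
      using B(2) by (auto simp: indicator_def)
    ultimately have "AE x in M. s * (H x * indicator B x) = 0"
      by (subst integral_nonneg_eq_0_iff_AE[symmetric]) auto
    then have "AE x in M. x \<notin> B"
    proof eventually_elim
      case (elim x)
      then show ?case using B(2) by (auto simp: indicator_def)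
    qed
    then show False
      using B by (simp add: AE_iff_null_sets[symmetric] null_sets_def)
  qed
  from this[of 1] this[of "-1"] show "AE x in M. H x = 0"
    by auto
next
  assume H: "AE x in M. H x = 0"
  show "\<forall>g\<in>L2 M. AE x in M. Q g x = 0"
  proof
    fix g assume g: "g \<in> L2 M"
    have "L2_inner M (Q g) (Q g) = 0"
      unfolding inner[OF Q[OF g] g] using H by (intro integral_eq_zero_AE) auto
    then show "AE x in M. Q g x = 0"
      by (simp add: L2_eq_0_iff Q g)
  qed
qed

text \<open>Moving \<open>S ^^ k\<close> across leaves \<open>T ^^ (k + j)\<close> on both sides,
  hence the symbol \<open>h (k + j)\<close>. The shift \<open>j = 0\<close> serves the
  \<open>m\<close>-isometry, \<open>j = 1\<close> the quasi-\<open>m\<close>-isometry.\<close>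

lemma weighted_adjoint_powers_inner:
  fixes c :: "nat \<Rightarrow> real"
  assumes "f \<in> L2 M" "g \<in> L2 M"
  shows "integrable M (\<lambda>x. of_real (\<Sum>k\<in>I. c k * h (k + j) x) * (f x * cnj (g x)))"
    and "L2_inner M ((T ^^ j) f) (\<lambda>x. \<Sum>k\<in>I. of_real (c k) * (S ^^ k) ((T ^^ (k + j)) g) x)
      = (\<integral>x. of_real (\<Sum>k\<in>I. c k * h (k + j) x) * (f x * cnj (g x)) \<partial>M)"
proof -
  let ?F = "\<lambda>k x. of_real (h (k + j) x) * (f x * cnj (g x))"
  have eq: "of_real (\<Sum>k\<in>I. c k * h (k + j) x) * (f x * cnj (g x)) = (\<Sum>k\<in>I. of_real (c k) * ?F k x)" for x
    by (simp add: sum_distrib_right mult.assoc)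
  show "integrable M (\<lambda>x. of_real (\<Sum>k\<in>I. c k * h (k + j) x) * (f x * cnj (g x)))"
    unfolding eq by (intro Bochner_Integration.integrable_sum integrable_mult_right T_funpow_inner(1) assms)
  have "L2_inner M ((T ^^ j) f) (\<lambda>x. \<Sum>k\<in>I. of_real (c k) * (S ^^ k) ((T ^^ (k + j)) g) x)
      = (\<integral>x. (\<Sum>k\<in>I. of_real (c k) * ((T ^^ j) f x * cnj ((S ^^ k) ((T ^^ (k + j)) g) x))) \<partial>M)"
    unfolding L2_inner_def by (simp add: sum_distrib_left mult.left_commute)
  also have "\<dots> = (\<Sum>k\<in>I. of_real (c k) * L2_inner M ((T ^^ j) f) ((S ^^ k) ((T ^^ (k + j)) g)))"
    unfolding L2_inner_def
    by (subst Bochner_Integration.integral_sum)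
       (auto intro!: integrable_mult_right L2_integrable_prod T_funpow_in_L2 S_funpow_in_L2 assms)
  also have "\<dots> = (\<Sum>k\<in>I. of_real (c k) * (\<integral>x. ?F k x \<partial>M))"
  proof (intro sum.cong refl arg_cong2[where f = "(*)"])
    fix k
    have "L2_inner M ((T ^^ j) f) ((S ^^ k) ((T ^^ (k + j)) g))
        = L2_inner M ((T ^^ k) ((T ^^ j) f)) ((T ^^ (k + j)) g)"
      by (rule is_adjoint_L2_funpow[OF T_in_L2 adjoint, symmetric]) (assumption | intro T_funpow_in_L2 assms)+
    also have "(T ^^ k) ((T ^^ j) f) = (T ^^ (k + j)) f"
      by (simp add: funpow_add)
    finally show "L2_inner M ((T ^^ j) f) ((S ^^ k) ((T ^^ (k + j)) g)) = (\<integral>x. ?F k x \<partial>M)"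
      using T_funpow_inner(2)[OF assms] by simp
  qed
  also have "\<dots> = (\<integral>x. (\<Sum>k\<in>I. of_real (c k) * ?F k x) \<partial>M)"
    by (subst Bochner_Integration.integral_sum)
       (auto intro!: integrable_mult_right T_funpow_inner(1) assms)
  finally show "L2_inner M ((T ^^ j) f) (\<lambda>x. \<Sum>k\<in>I. of_real (c k) * (S ^^ k) ((T ^^ (k + j)) g) x)
      = (\<integral>x. of_real (\<Sum>k\<in>I. c k * h (k + j) x) * (f x * cnj (g x)) \<partial>M)"
    unfolding eq .
qed

text \<open>Merges the powers of \<open>T\<close> and makes the coefficients real, to match
  \<open>weighted_adjoint_powers_inner\<close>.\<close>

lemma defect_operator_T:
  "defect_operator M m T ((T ^^ j) g)
    = (\<lambda>x. \<Sum>k=0..m. of_real ((-1) ^ (m - k) * real (m choose k)) * (S ^^ k) ((T ^^ (k + j)) g) x)"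
  unfolding defect_operator_def by (simp add: funpow_add)

lemma defect_operator_T_in_L2: "g \<in> L2 M \<Longrightarrow> defect_operator M m T ((T ^^ j) g) \<in> L2 M"
  unfolding defect_operator_T
  by (intro L2_sum L2_cmult S_funpow_in_L2 T_funpow_in_L2)

lemma m_isometry_iff:
  "m_isometry M m T \<longleftrightarrow> (AE x in M. (\<Sum>k=0..m. (-1) ^ (m - k) * real (m choose k) * h k x) = 0)"
  unfolding m_isometry_def
proof (rule operator_zero_iff_symbol_zero)
  fix f g assume fg: "f \<in> L2 M" "g \<in> L2 M"
  from defect_operator_T_in_L2[OF fg(2), of m 0] show "defect_operator M m T g \<in> L2 M"
    by simp
  note * = weighted_adjoint_powers_inner[OF fg, where I = "{0..m}" and j = 0
      and c = "\<lambda>k. (-1) ^ (m - k) * real (m choose k)"]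
  from *(1)
  show "integrable M (\<lambda>x. of_real (\<Sum>k=0..m. (-1) ^ (m - k) * real (m choose k) * h k x) * (f x * cnj (g x)))"
    by simp
  from *(2)[folded defect_operator_T]
  show "L2_inner M f (defect_operator M m T g)
      = (\<integral>x. of_real (\<Sum>k=0..m. (-1) ^ (m - k) * real (m choose k) * h k x) * (f x * cnj (g x)) \<partial>M)"
    by simp
qed measurable

lemma quasi_m_isometry_iff:
  "quasi_m_isometry M m T \<longleftrightarrow> (AE x in M. (\<Sum>k=0..m. (-1) ^ (m - k) * real (m choose k) * h (k + 1) x) = 0)"
  unfolding quasi_m_isometry_def
proof (rule operator_zero_iff_symbol_zero)
  fix f g assume fg: "f \<in> L2 M" "g \<in> L2 M"
  have D: "defect_operator M m T (T g) \<in> L2 M"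
    using defect_operator_T_in_L2[OF fg(2), of m 1] by simp
  then show "S (defect_operator M m T (T g)) \<in> L2 M"
    by (rule S_in_L2)
  note * = weighted_adjoint_powers_inner[OF fg, where I = "{0..m}" and j = 1
      and c = "\<lambda>k. (-1) ^ (m - k) * real (m choose k)"]
  show "integrable M (\<lambda>x. of_real (\<Sum>k=0..m. (-1) ^ (m - k) * real (m choose k) * h (k + 1) x) * (f x * cnj (g x)))"
    by (rule *(1))
  \<comment> \<open>The outer adjoint puts a \<open>T\<close> on \<open>f\<close>, which is the left
    argument for \<open>j = 1\<close>.\<close>
  have "L2_inner M f (S (defect_operator M m T (T g))) = L2_inner M (T f) (defect_operator M m T (T g))"
    using adjoint fg(1) D by (simp add: is_adjoint_L2_def)
  also have "\<dots> = (\<integral>x. of_real (\<Sum>k=0..m. (-1) ^ (m - k) * real (m choose k) * h (k + 1) x) * (f x * cnj (g x)) \<partial>M)"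
    using *(2)[folded defect_operator_T] by simp
  finally show "L2_inner M f (S (defect_operator M m T (T g)))
      = (\<integral>x. of_real (\<Sum>k=0..m. (-1) ^ (m - k) * real (m choose k) * h (k + 1) x) * (f x * cnj (g x)) \<partial>M)" .
qed measurable

end

theorem corollary2p2:
  fixes M :: "'a measure" and \<phi> :: "'a \<Rightarrow> 'a" and m :: nat
  assumes "\<phi> \<in> measurable M M"
    and "nonsingular M \<phi>"
    and "RN_derivs_well_defined M \<phi>"
    and "bounded_operator_L2 M (composition_operator \<phi>)"
  shows "(quasi_m_isometry M m (composition_operator \<phi>) \<longleftrightarrow>
            (AE x in M. (\<Sum>k=0..m. (-1) ^ (m - k) * real (m choose k) * enn2real (h_RN M \<phi> (k + 1) x)) = 0))
       \<and> (m_isometry M m (composition_operator \<phi>) \<longleftrightarrow>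
            (AE x in M. (\<Sum>k=0..m. (-1) ^ (m - k) * real (m choose k) * enn2real (h_RN M \<phi> k x)) = 0))"
proof -
  interpret bounded_composition_operator M \<phi>
    using assms by unfold_locales
  show ?thesis
    using quasi_m_isometry_iff m_isometry_iff by blast
qed

end
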